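(* Let $\lambda_1\ge\lambda_2\ge\lambda_3\ge\lambda_4\ge0$ with $\sum_i\lambda_i=1$, and let $$\rho_{\vec\lambda}=\lambda_1\Phi_1+\lambda_2|01\rangle\langle01|+\lambda_3\Phi_2+\lambda_4|10\rangle\langle10|,\qquad \sigma_{\vec\lambda}=\sum_{j=1}^4\lambda_j\Phi_j.$$ If $1-\lambda_1-2\lambda_2\ge 0$, then there exists a non-entangling map $\Lambda:\mathcal{D}\to\mathcal{D}$ such that $\Lambda(\rho_{\vec\lambda})=\sigma_{\vec\lambda}$.
   Context: $\mathcal{D}$ is the set of two-qubit density matrices on $\mathbb{C}^2\otimes\mathbb{C}^2$ (Hermitian, positive semidefinite, trace one $4\times4$ matrices), written in the computational basis $\{|ij\rangle\}_{i,j\in\{0,1\}}$. The Bell vectors are $|\Phi_1\rangle=\frac{1}{\sqrt2}(|00\rangle+|11\rangle)$, $|\Phi_2\rangle=\frac{1}{\sqrt2}(|00\rangle-|11\rangle)$, $|\Phi_3\rangle=\frac{1}{\sqrt2}(|10\rangle+|01\rangle)$, $|\Phi_4\rangle=\frac{1}{\sqrt2}(|10\rangle-|01\rangle)$, and $\Phi_i=|\Phi_i\rangle\langle\Phi_i|$. A state is separable if it is a convex combination of product states $|\phi\rangle\langle\phi|\otimes|\chi\rangle\langle\chi|$. A map $\Lambda:\mathcal{D}\to\mathcal{D}$ is non-entangling (NE) if it is completely positive and trace preserving and maps every separable state to a separable state. *)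

theory Defs
  imports "Jordan_Normal_Form.Matrix"
begin

text \<open>Two-qubit states are 4x4 complex matrices (Jordan_Normal_Form type complex mat) in the
computational basis, with the basis vector of index i j (i,j in 0,1) at position 2*i+j.\<close>

definition mtrace :: "complex mat \<Rightarrow> complex" where
  "mtrace A = (\<Sum>i<dim_row A. A $$ (i,i))"

definition hermitian_mat :: "nat \<Rightarrow> complex mat \<Rightarrow> bool" where
  "hermitian_mat n A \<longleftrightarrow> A \<in> carrier_mat n n \<and>
     (\<forall>i<n. \<forall>j<n. A $$ (j,i) = cnj (A $$ (i,j)))"

definition qform :: "nat \<Rightarrow> complex mat \<Rightarrow> complex vec \<Rightarrow> complex" where
  "qform n A v = (\<Sum>i<n. \<Sum>j<n. cnj (v $ i) * A $$ (i,j) * v $ j)"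

definition psd_mat :: "nat \<Rightarrow> complex mat \<Rightarrow> bool" where
  "psd_mat n A \<longleftrightarrow> hermitian_mat n A \<and>
     (\<forall>v \<in> carrier_vec n. Im (qform n A v) = 0 \<and> Re (qform n A v) \<ge> 0)"

definition density_mat :: "complex mat \<Rightarrow> bool" where
  "density_mat \<rho> \<longleftrightarrow> psd_mat 4 \<rho> \<and> mtrace \<rho> = 1"

definition ketbra :: "nat \<Rightarrow> complex vec \<Rightarrow> complex mat" where
  "ketbra n v = mat n n (\<lambda>(i,j). v $ i * cnj (v $ j))"

definition unit_vec2 :: "complex vec \<Rightarrow> bool" where
  "unit_vec2 v \<longleftrightarrow> v \<in> carrier_vec 2 \<and> (\<Sum>i<2. (cmod (v $ i))\<^sup>2) = 1"

definition tensor2 :: "complex vec \<Rightarrow> complex vec \<Rightarrow> complex vec" where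
  "tensor2 \<phi> \<chi> = vec 4 (\<lambda>r. \<phi> $ (r div 2) * \<chi> $ (r mod 2))"

definition product_state :: "complex vec \<Rightarrow> complex vec \<Rightarrow> complex mat" where
  "product_state \<phi> \<chi> = ketbra 4 (tensor2 \<phi> \<chi>)"

definition separable :: "complex mat \<Rightarrow> bool" where
  "separable \<rho> \<longleftrightarrow> (\<exists>m::nat. \<exists>p::nat \<Rightarrow> real. \<exists>\<phi> \<chi> :: nat \<Rightarrow> complex vec.
      (\<forall>k<m. p k \<ge> 0 \<and> unit_vec2 (\<phi> k) \<and> unit_vec2 (\<chi> k)) \<and>
      (\<Sum>k<m. p k) = 1 \<and>
      \<rho> = mat 4 4 (\<lambda>rc. \<Sum>k<m. complex_of_real (p k) * product_state (\<phi> k) (\<chi> k) $$ rc))"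

text \<open>Apply a map on 4x4 matrices blockwise to a (4n)x(4n) matrix viewed as an element of
M_n (x) M_4 (row index 4*i+a), i.e. the map id_n (x) Lambda.\<close>
definition ext_map :: "nat \<Rightarrow> (complex mat \<Rightarrow> complex mat) \<Rightarrow> complex mat \<Rightarrow> complex mat" where
  "ext_map n \<Lambda> M = mat (4*n) (4*n) (\<lambda>(r,c).
      \<Lambda> (mat 4 4 (\<lambda>(a,b). M $$ (4*(r div 4) + a, 4*(c div 4) + b))) $$ (r mod 4, c mod 4))"

definition linear_map4 :: "(complex mat \<Rightarrow> complex mat) \<Rightarrow> bool" where
  "linear_map4 \<Lambda> \<longleftrightarrow>
     (\<forall>A \<in> carrier_mat 4 4. \<Lambda> A \<in> carrier_mat 4 4) \<and>
     (\<forall>A \<in> carrier_mat 4 4. \<forall>B \<in> carrier_mat 4 4. \<Lambda> (A + B) = \<Lambda> A + \<Lambda> B) \<and>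
     (\<forall>A \<in> carrier_mat 4 4. \<forall>c::complex. \<Lambda> (c \<cdot>\<^sub>m A) = c \<cdot>\<^sub>m \<Lambda> A)"

definition completely_positive :: "(complex mat \<Rightarrow> complex mat) \<Rightarrow> bool" where
  "completely_positive \<Lambda> \<longleftrightarrow>
     (\<forall>n::nat. \<forall>M. psd_mat (4*n) M \<longrightarrow> psd_mat (4*n) (ext_map n \<Lambda> M))"

definition trace_preserving :: "(complex mat \<Rightarrow> complex mat) \<Rightarrow> bool" where
  "trace_preserving \<Lambda> \<longleftrightarrow> (\<forall>A \<in> carrier_mat 4 4. mtrace (\<Lambda> A) = mtrace A)"

definition CPTP :: "(complex mat \<Rightarrow> complex mat) \<Rightarrow> bool" where
  "CPTP \<Lambda> \<longleftrightarrow> linear_map4 \<Lambda> \<and> completely_positive \<Lambda> \<and> trace_preserving \<Lambda>"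

definition non_entangling :: "(complex mat \<Rightarrow> complex mat) \<Rightarrow> bool" where
  "non_entangling \<Lambda> \<longleftrightarrow> CPTP \<Lambda> \<and> (\<forall>\<rho>. separable \<rho> \<longrightarrow> separable (\<Lambda> \<rho>))"

definition ket :: "nat \<Rightarrow> nat \<Rightarrow> complex vec" where
  "ket i j = unit_vec 4 (2*i + j)"

definition Bell1 :: "complex vec" where "Bell1 = complex_of_real (1 / sqrt 2) \<cdot>\<^sub>v (ket 0 0 + ket 1 1)"
definition Bell2 :: "complex vec" where "Bell2 = complex_of_real (1 / sqrt 2) \<cdot>\<^sub>v (ket 0 0 - ket 1 1)"
definition Bell3 :: "complex vec" where "Bell3 = complex_of_real (1 / sqrt 2) \<cdot>\<^sub>v (ket 1 0 + ket 0 1)"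
definition Bell4 :: "complex vec" where "Bell4 = complex_of_real (1 / sqrt 2) \<cdot>\<^sub>v (ket 1 0 - ket 0 1)"

definition Phi :: "nat \<Rightarrow> complex mat" where
  "Phi k = ketbra 4 (if k = 1 then Bell1 else if k = 2 then Bell2 else if k = 3 then Bell3 else Bell4)"

definition rho_lam :: "real \<Rightarrow> real \<Rightarrow> real \<Rightarrow> real \<Rightarrow> complex mat" where
  "rho_lam l1 l2 l3 l4 =
     of_real l1 \<cdot>\<^sub>m Phi 1 + of_real l2 \<cdot>\<^sub>m ketbra 4 (ket 0 1)
     + of_real l3 \<cdot>\<^sub>m Phi 2 + of_real l4 \<cdot>\<^sub>m ketbra 4 (ket 1 0)"

definition sigma_lam :: "real \<Rightarrow> real \<Rightarrow> real \<Rightarrow> real \<Rightarrow> complex mat" where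
  "sigma_lam l1 l2 l3 l4 =
     of_real l1 \<cdot>\<^sub>m Phi 1 + of_real l2 \<cdot>\<^sub>m Phi 2 + of_real l3 \<cdot>\<^sub>m Phi 3 + of_real l4 \<cdot>\<^sub>m Phi 4"

end

theory Submission
  imports Defs
begin

text \<open>The map measures whether the input is the first Bell state. On success (probability x) it
prepares that Bell state again; otherwise it prepares the Bell-diagonal state whose weights t2, t3, t4
are l2, l3, l4 divided by 1 - l1. The hypothesis says exactly that these weights are at most 1/2.
A separable input has x at most 1/2, so the output is a Bell-diagonal state all of whose weights are
at most 1/2, and such a state is a mixture of midpoints of pairs of Bell states, which are
separable.\<close>

section \<open>Kraus maps and their complete positivity\<close>

definition kraus_map :: "'k set \<Rightarrow> ('k \<Rightarrow> complex mat) \<Rightarrow> complex mat \<Rightarrow> complex mat" where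
  "kraus_map I K A = mat 4 4 (\<lambda>(a,b).
     \<Sum>k\<in>I. \<Sum>c<4. \<Sum>d<4. K k $$ (a,c) * A $$ (c,d) * cnj (K k $$ (b,d)))"

lemma linear_map4_kraus_map: "linear_map4 (kraus_map I K)"
proof -
  have "kraus_map I K (A + B) = kraus_map I K A + kraus_map I K B"
    if "A \<in> carrier_mat 4 4" "B \<in> carrier_mat 4 4" for A B
    using that by (intro eq_matI) (simp_all add: kraus_map_def distrib_left distrib_right sum.distrib)
  moreover have "kraus_map I K (c \<cdot>\<^sub>m A) = c \<cdot>\<^sub>m kraus_map I K A"
    if "A \<in> carrier_mat 4 4" for A c
    using that by (intro eq_matI) (simp_all add: kraus_map_def sum_distrib_left mult_ac)
  ultimately show ?thesis
    unfolding linear_map4_def by (simp add: kraus_map_def)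
qed

text \<open>Splits an index of M_n (x) M_4 into a block number and an inner index, so that quadratic
  forms of \<open>ext_map\<close> can be expanded blockwise.\<close>

lemma sum_lessThan_mult4: "(\<Sum>r<4*n. f r) = (\<Sum>i<n. \<Sum>a<4. f (4*i+a))"
  for f :: "nat \<Rightarrow> 'a::comm_monoid_add"
proof (induction n)
  case (Suc n)
  have "{..<4 * Suc n} = {..<4*n + 4}" by simp
  moreover have "(\<Sum>r<4*n + 4. f r) = (\<Sum>r<4*n. f r) + (\<Sum>a<4. f (4*n+a))"
    by (simp add: numeral_eq_Suc add.assoc)
  ultimately show ?case by (simp only: Suc.IH sum.lessThan_Suc)
qed simp

lemma sum_swap_pair_triple:
  fixes F :: "'a \<Rightarrow> 'b \<Rightarrow> 'k \<Rightarrow> 'c \<Rightarrow> 'd \<Rightarrow> 'e::comm_monoid_add"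
  shows "(\<Sum>a\<in>A. \<Sum>b\<in>B. \<Sum>k\<in>I. \<Sum>c\<in>C. \<Sum>d\<in>D. F a b k c d)
       = (\<Sum>k\<in>I. \<Sum>c\<in>C. \<Sum>d\<in>D. \<Sum>a\<in>A. \<Sum>b\<in>B. F a b k c d)"
    (is "?lhs = _")
proof -
  have "?lhs = (\<Sum>a\<in>A. \<Sum>k\<in>I. \<Sum>b\<in>B. \<Sum>c\<in>C. \<Sum>d\<in>D. F a b k c d)"
    by (rule sum.cong[OF refl], rule sum.swap)
  also have "\<dots> = (\<Sum>k\<in>I. \<Sum>a\<in>A. \<Sum>b\<in>B. \<Sum>c\<in>C. \<Sum>d\<in>D. F a b k c d)"
    by (rule sum.swap)
  also have "\<dots> = (\<Sum>k\<in>I. \<Sum>a\<in>A. \<Sum>c\<in>C. \<Sum>b\<in>B. \<Sum>d\<in>D. F a b k c d)"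
    by (rule sum.cong[OF refl], rule sum.cong[OF refl], rule sum.swap)
  also have "\<dots> = (\<Sum>k\<in>I. \<Sum>c\<in>C. \<Sum>a\<in>A. \<Sum>b\<in>B. \<Sum>d\<in>D. F a b k c d)"
    by (rule sum.cong[OF refl], rule sum.swap)
  also have "\<dots> = (\<Sum>k\<in>I. \<Sum>c\<in>C. \<Sum>a\<in>A. \<Sum>d\<in>D. \<Sum>b\<in>B. F a b k c d)"
    by (rule sum.cong[OF refl], rule sum.cong[OF refl], rule sum.cong[OF refl], rule sum.swap)
  also have "\<dots> = (\<Sum>k\<in>I. \<Sum>c\<in>C. \<Sum>d\<in>D. \<Sum>a\<in>A. \<Sum>b\<in>B. F a b k c d)"
    by (rule sum.cong[OF refl], rule sum.cong[OF refl], rule sum.swap)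
  finally show ?thesis .
qed

lemma sum_mult_sum:
  fixes m :: "'a::comm_ring"
  shows "sum f A * m * sum g B = (\<Sum>a\<in>A. \<Sum>b\<in>B. f a * m * g b)"
  by (simp only: sum_distrib_right) (simp only: sum_distrib_left)

lemma completely_positive_kraus_map: "completely_positive (kraus_map I K)"
  unfolding completely_positive_def
proof (intro allI impI)
  fix n :: nat and M assume "psd_mat (4*n) M"
  then have herm: "\<And>i j. i < 4*n \<Longrightarrow> j < 4*n \<Longrightarrow> M $$ (j,i) = cnj (M $$ (i,j))"
    and pos: "\<And>v. v \<in> carrier_vec (4*n) \<Longrightarrow> Im (qform (4*n) M v) = 0 \<and> Re (qform (4*n) M v) \<ge> 0"
    unfolding psd_mat_def hermitian_mat_def by blast+
  define N where "N = ext_map n (kraus_map I K) M"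
  have N: "N $$ (r,s) = (\<Sum>k\<in>I. \<Sum>c<4. \<Sum>d<4. K k $$ (r mod 4, c)
      * M $$ (4*(r div 4) + c, 4*(s div 4) + d) * cnj (K k $$ (s mod 4, d)))"
    if "r < 4*n" "s < 4*n" for r s
    using that by (simp add: N_def ext_map_def kraus_map_def)
  have bound: "4 * (r div 4) + c < 4*n" if "r < 4*n" "c < 4" for r c :: nat
    using that by presburger
  have bound': "4 * i + c < 4*n" if "i < n" "c < 4" for i c :: nat
    using that by presburger
  have hermN: "N $$ (s,r) = cnj (N $$ (r,s))" if rs: "r < 4*n" "s < 4*n" for r s
  proof -
    have "cnj (N $$ (r,s)) = (\<Sum>k\<in>I. \<Sum>c<4. \<Sum>d<4. K k $$ (s mod 4, d)
      * M $$ (4*(s div 4) + d, 4*(r div 4) + c) * cnj (K k $$ (r mod 4, c)))"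
      unfolding N[OF rs] cnj_sum
      using rs by (intro sum.cong refl) (simp add: herm[OF bound bound, of r _ s] mult_ac)
    also have "\<dots> = N $$ (s,r)"
      \<comment> \<open>Conjugation has exchanged the roles of c and d.\<close>
      unfolding N[OF rs(2,1)] by (rule sum.cong[OF refl], rule sum.swap)
    finally show ?thesis by simp
  qed
  have qN: "\<exists>w. (\<forall>k. w k \<in> carrier_vec (4*n)) \<and> qform (4*n) N v = (\<Sum>k\<in>I. qform (4*n) M (w k))"
    if "v \<in> carrier_vec (4*n)" for v
  proof (intro exI conjI allI)
    \<comment> \<open>The adjoint of \<open>K k\<close> applied to each block of v.\<close>
    let ?w = "\<lambda>k. vec (4*n) (\<lambda>r. \<Sum>a<4. cnj (K k $$ (a, r mod 4)) * v $ (4*(r div 4) + a))"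
    show "?w k \<in> carrier_vec (4*n)" for k by simp
    \<comment> \<open>Both quadratic forms expand into sevenfold sums of this one summand. Only the
      order of summation differs, and the chain below rearranges it.\<close>
    define F where "F = (\<lambda>i j a b k c d. K k $$ (a,c) * cnj (v $ (4*i+a)) *
       M $$ (4*i+c, 4*j+d) * (cnj (K k $$ (b,d)) * v $ (4*j+b)))"
    have "qform (4*n) N v = (\<Sum>i<n. \<Sum>a<4. \<Sum>j<n. \<Sum>b<4. \<Sum>k\<in>I. \<Sum>c<4. \<Sum>d<4. F i j a b k c d)"
      unfolding qform_def sum_lessThan_mult4 F_def
      by (intro sum.cong refl)
        (simp add: N bound' sum_distrib_left sum_distrib_right mult_ac)
    also have "\<dots> = (\<Sum>i<n. \<Sum>j<n. \<Sum>a<4. \<Sum>b<4. \<Sum>k\<in>I. \<Sum>c<4. \<Sum>d<4. F i j a b k c d)"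
      by (rule sum.cong[OF refl], rule sum.swap)
    also have "\<dots> = (\<Sum>i<n. \<Sum>j<n. \<Sum>k\<in>I. \<Sum>c<4. \<Sum>d<4. \<Sum>a<4. \<Sum>b<4. F i j a b k c d)"
      by (rule sum.cong[OF refl], rule sum.cong[OF refl], rule sum_swap_pair_triple)
    also have "\<dots> = (\<Sum>i<n. \<Sum>k\<in>I. \<Sum>j<n. \<Sum>c<4. \<Sum>d<4. \<Sum>a<4. \<Sum>b<4. F i j a b k c d)"
      by (rule sum.cong[OF refl], rule sum.swap)
    also have "\<dots> = (\<Sum>k\<in>I. \<Sum>i<n. \<Sum>j<n. \<Sum>c<4. \<Sum>d<4. \<Sum>a<4. \<Sum>b<4. F i j a b k c d)"
      by (rule sum.swap)
    also have "\<dots> = (\<Sum>k\<in>I. \<Sum>i<n. \<Sum>c<4. \<Sum>j<n. \<Sum>d<4. \<Sum>a<4. \<Sum>b<4. F i j a b k c d)"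
      by (rule sum.cong[OF refl], rule sum.cong[OF refl], rule sum.swap)
    also have "\<dots> = (\<Sum>k\<in>I. qform (4*n) M (?w k))"
      unfolding qform_def sum_lessThan_mult4 F_def
      by (intro sum.cong refl)
        (simp add: bound' sum_mult_sum)
    finally show "qform (4*n) N v = (\<Sum>k\<in>I. qform (4*n) M (?w k))" .
  qed
  have "Im (qform (4*n) N v) = 0 \<and> Re (qform (4*n) N v) \<ge> 0" if "v \<in> carrier_vec (4*n)" for v
    proof -
    obtain w where w: "\<And>k. w k \<in> carrier_vec (4*n)"
      and q: "qform (4*n) N v = (\<Sum>k\<in>I. qform (4*n) M (w k))"
      using qN[OF \<open>v \<in> carrier_vec (4*n)\<close>] by blast
    show ?thesis
      unfolding q using pos[OF w] by (simp add: sum_nonneg)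
  qed
  moreover have "N \<in> carrier_mat (4*n) (4*n)" by (simp add: N_def ext_map_def)
  ultimately have "psd_mat (4*n) N"
    using hermN unfolding psd_mat_def hermitian_mat_def by blast
  then show "psd_mat (4*n) (ext_map n (kraus_map I K) M)" by (simp add: N_def)
qed

section \<open>Bell projectors and the measure-and-prepare channel\<close>

definition bell :: "nat \<Rightarrow> complex vec" where
  "bell k = (if k = 1 then Bell1 else if k = 2 then Bell2 else if k = 3 then Bell3 else Bell4)"

lemma Phi_eq_ketbra_bell: "Phi k = ketbra 4 (bell k)"
  by (simp add: Phi_def bell_def)

lemma Phi_carrier [simp]: "Phi k \<in> carrier_mat 4 4" "dim_row (Phi k) = 4" "dim_col (Phi k) = 4"
  by (simp_all add: Phi_eq_ketbra_bell ketbra_def)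

lemma inverse_sqrt2_squared:
  "complex_of_real (1 / sqrt 2) * complex_of_real (1 / sqrt 2) = 1/2"
  unfolding of_real_mult[symmetric] by simp

text \<open>The factor 1/sqrt 2 enters only squared, so all entries are rational. The support is the
  block of 00 and 11 (positions 0, 3) or of 01 and 10 (positions 1, 2).\<close>

lemma Phi_explicit:
  "Phi 1 = mat 4 4 (\<lambda>(i,j). if i \<in> {0,3} \<and> j \<in> {0,3} then 1/2 else 0)"
  "Phi 2 = mat 4 4 (\<lambda>(i,j). if i \<in> {0,3} \<and> j \<in> {0,3} then (if i = j then 1/2 else -1/2) else 0)"
  "Phi 3 = mat 4 4 (\<lambda>(i,j). if i \<in> {1,2} \<and> j \<in> {1,2} then 1/2 else 0)"
  "Phi 4 = mat 4 4 (\<lambda>(i,j). if i \<in> {1,2} \<and> j \<in> {1,2} then (if i = j then 1/2 else -1/2) else 0)"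
  using inverse_sqrt2_squared
  by (auto intro!: eq_matI simp: Phi_def ketbra_def Bell1_def Bell2_def Bell3_def Bell4_def ket_def
      less_Suc_eq numeral_eq_Suc)

text \<open>The right-hand side is tr(A \<open>Phi k\<close>). Passing to the projector lets
  \<open>Phi_explicit\<close> remove all square roots.\<close>

lemma qform_bell: "qform 4 A (bell k) = (\<Sum>i<4. \<Sum>j<4. A $$ (i,j) * Phi k $$ (j,i))"
  unfolding qform_def by (intro sum.cong refl) (simp add: Phi_eq_ketbra_bell ketbra_def mult_ac)

text \<open>The Bell vectors are an orthonormal basis, so their projectors sum to the
  identity.\<close>

lemma qform_bell_sum:
  assumes "A \<in> carrier_mat 4 4"
  shows "qform 4 A (bell 1) + qform 4 A (bell 2) + qform 4 A (bell 3) + qform 4 A (bell 4) = mtrace A"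
  using assms unfolding qform_bell mtrace_def Phi_explicit
  by (simp add: numeral_eq_Suc)

lemma mtrace_Phi: "mtrace (Phi 1) = 1" "mtrace (Phi 2) = 1" "mtrace (Phi 3) = 1" "mtrace (Phi 4) = 1"
  unfolding Phi_explicit by (simp_all add: mtrace_def numeral_eq_Suc)

text \<open>The operators sqrt(c j l) |bell j><bell l|: a Bell measurement with outcome l, then
  preparation of \<open>Phi j\<close> with weight \<open>c j l\<close>.\<close>

definition bell_kraus :: "(nat \<Rightarrow> nat \<Rightarrow> real) \<Rightarrow> nat \<times> nat \<Rightarrow> complex mat" where
  "bell_kraus c = (\<lambda>(j,l). mat 4 4 (\<lambda>(a,b).
     complex_of_real (sqrt (c j l)) * bell j $ a * cnj (bell l $ b)))"

lemma kraus_map_bell_kraus: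
  assumes c: "\<And>j l. c j l \<ge> 0"
  shows "kraus_map (J \<times> L) (bell_kraus c) A = mat 4 4 (\<lambda>ab.
    \<Sum>j\<in>J. \<Sum>l\<in>L. complex_of_real (c j l) * qform 4 A (bell l) * Phi j $$ ab)"
proof (rule eq_matI, goal_cases)
  case (1 a b)
  then have ab: "a < 4" "b < 4" by auto
  have sq: "complex_of_real (c j l) = complex_of_real (sqrt (c j l)) * complex_of_real (sqrt (c j l))"
    for j l
    unfolding of_real_mult[symmetric] using c[of j l] by simp
  have "kraus_map (J \<times> L) (bell_kraus c) A $$ (a,b) = (\<Sum>(j,l)\<in>J \<times> L. \<Sum>i<4. \<Sum>d<4.
      (complex_of_real (sqrt (c j l)) * complex_of_real (sqrt (c j l)))
      * (cnj (bell l $ i) * A $$ (i,d) * bell l $ d) * (bell j $ a * cnj (bell j $ b)))"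
    using ab by (simp add: kraus_map_def)
      (intro sum.cong refl, auto simp: bell_kraus_def mult_ac intro!: sum.cong)
  also have "\<dots> = (\<Sum>(j,l)\<in>J \<times> L. complex_of_real (c j l) * qform 4 A (bell l) * Phi j $$ (a,b))"
    unfolding sq[symmetric] qform_def Phi_eq_ketbra_bell ketbra_def
    using ab by (simp add: sum_distrib_left sum_distrib_right)
  finally show ?case using ab by (simp add: sum.cartesian_product)
qed (simp_all add: kraus_map_def)

text \<open>The two-outcome test is realised as a full Bell measurement that treats outcomes 2, 3
  and 4 alike. In Kraus form, linearity and complete positivity follow from the general
  lemmas.\<close>

definition bell_channel :: "real \<Rightarrow> real \<Rightarrow> real \<Rightarrow> complex mat \<Rightarrow> complex mat" where
  "bell_channel t2 t3 t4 = kraus_map ({1,2,3,4} \<times> {1,2,3,4}) (bell_kraus (\<lambda>j l.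
     if l = 1 then of_bool (j = 1)
     else if j = 1 then 0 else if j = 2 then t2 else if j = 3 then t3 else t4))"

text \<open>By completeness of the Bell basis, outcomes 2, 3 and 4 together carry the trace minus
  the weight of outcome 1. Nonnegativity of the weights lets the square roots in the Kraus operators
  multiply back to them.\<close>

lemma bell_channel_eq:
  assumes "t2 \<ge> 0" "t3 \<ge> 0" "t4 \<ge> 0" and A: "A \<in> carrier_mat 4 4"
  shows "bell_channel t2 t3 t4 A = mat 4 4 (\<lambda>ab. qform 4 A (bell 1) * Phi 1 $$ ab
    + (mtrace A - qform 4 A (bell 1)) * (of_real t2 * Phi 2 $$ ab + of_real t3 * Phi 3 $$ ab
      + of_real t4 * Phi 4 $$ ab))"
  unfolding bell_channel_def qform_bell_sum[OF A, symmetric]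
  using assms by (subst kraus_map_bell_kraus) (auto intro!: arg_cong[where f = "mat 4 4"] simp: algebra_simps)

lemma CPTP_bell_channel:
  assumes t: "t2 \<ge> 0" "t3 \<ge> 0" "t4 \<ge> 0" "t2 + t3 + t4 = 1"
  shows "CPTP (bell_channel t2 t3 t4)"
proof -
  have "mtrace (bell_channel t2 t3 t4 A) = mtrace A" if "A \<in> carrier_mat 4 4" for A
  proof -
    let ?x = "qform 4 A (bell 1)"
    have "mtrace (bell_channel t2 t3 t4 A) = ?x * mtrace (Phi 1) + (mtrace A - ?x) *
       (of_real t2 * mtrace (Phi 2) + of_real t3 * mtrace (Phi 3) + of_real t4 * mtrace (Phi 4))"
      unfolding bell_channel_eq[OF t(1-3) that] unfolding mtrace_def[of "Phi _"] mtrace_def[of "mat _ _ _"]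
      by (simp add: sum.distrib sum_distrib_left distrib_left)
    also have "\<dots> = ?x + (mtrace A - ?x) * complex_of_real (t2 + t3 + t4)"
      unfolding mtrace_Phi by simp
    finally show ?thesis using t(4) by simp
  qed
  then show ?thesis
    unfolding CPTP_def trace_preserving_def bell_channel_def
    using linear_map4_kraus_map completely_positive_kraus_map by blast
qed

section \<open>Separable Bell-diagonal states\<close>

lemma separableI_list:
  assumes "\<forall>(p,\<phi>,\<chi>)\<in>set xs. p \<ge> 0 \<and> unit_vec2 \<phi> \<and> unit_vec2 \<chi>"
    and "(\<Sum>(p,\<phi>,\<chi>)\<leftarrow>xs. p) = 1"
    and "\<rho> = mat 4 4 (\<lambda>rc. \<Sum>(p,\<phi>,\<chi>)\<leftarrow>xs. complex_of_real p * product_state \<phi> \<chi> $$ rc)"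
  shows "separable \<rho>"
  unfolding separable_def
proof (intro exI conjI)
  let ?p = "\<lambda>k. fst (xs ! k)" and ?\<phi> = "\<lambda>k. fst (snd (xs ! k))" and ?\<chi> = "\<lambda>k. snd (snd (xs ! k))"
  show "\<forall>k<length xs. ?p k \<ge> 0 \<and> unit_vec2 (?\<phi> k) \<and> unit_vec2 (?\<chi> k)"
    using assms(1) by (force simp: case_prod_unfold)
  show "(\<Sum>k<length xs. ?p k) = 1"
    using assms(2) by (simp add: sum_list_sum_nth case_prod_unfold atLeast0LessThan)
  show "\<rho> = mat 4 4 (\<lambda>rc. \<Sum>k<length xs. complex_of_real (?p k) * product_state (?\<phi> k) (?\<chi> k) $$ rc)"
    using assms(3) by (simp add: sum_list_sum_nth case_prod_unfold atLeast0LessThan)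
qed

text \<open>For |z| = 1, a state on the equator of the Bloch sphere: z = 1, -1 give the eigenvectors
  of Pauli X, and z = \<i>, -\<i> those of Pauli Y.\<close>

definition equator :: "complex \<Rightarrow> complex vec" where
  "equator z = vec 2 (\<lambda>i. complex_of_real (1 / sqrt 2) * (if i = 0 then 1 else z))"

lemma unit_vec2_equator: "cmod z = 1 \<Longrightarrow> unit_vec2 (equator z)"
  by (simp add: unit_vec2_def equator_def numeral_eq_Suc norm_mult norm_divide power_divide)

lemma unit_vec2_unit_vec: "i < 2 \<Longrightarrow> unit_vec2 (unit_vec 2 i)"
  by (auto simp: unit_vec2_def numeral_eq_Suc less_Suc_eq)

lemma product_state_equator:
  assumes "r < 4" "c < 4"
  shows "product_state (equator z) (equator w) $$ (r,c) =
    (if r < 2 then 1 else z) * (if even r then 1 else w)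
    * cnj ((if c < 2 then 1 else z) * (if even c then 1 else w)) / 4"
proof -
  let ?s = "complex_of_real (1 / sqrt 2)"
  have eq: "equator z $ i = ?s * (if i = 0 then 1 else z)" if "i < 2" for i z
    using that by (simp add: equator_def)
  have "product_state (equator z) (equator w) $$ (r,c) =
     (equator z $ (r div 2) * equator w $ (r mod 2)) * cnj (equator z $ (c div 2) * equator w $ (c mod 2))"
    using assms by (simp add: product_state_def ketbra_def tensor2_def)
  also have "\<dots> = (?s * ?s) * (?s * ?s) * ((if r < 2 then 1 else z) * (if even r then 1 else w)
    * cnj ((if c < 2 then 1 else z) * (if even c then 1 else w)))"
  proof -
    have "r div 2 < 2" "c div 2 < 2" "r mod 2 < 2" "c mod 2 < 2" using assms by auto
    moreover have "r div 2 = 0 \<longleftrightarrow> r < 2" "c div 2 = 0 \<longleftrightarrow> c < 2" by auto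
    ultimately show ?thesis
      by (simp only: eq even_iff_mod_2_eq_zero complex_cnj_mult complex_cnj_complex_of_real mult_ac)
  qed
  finally show ?thesis unfolding inverse_sqrt2_squared by simp
qed

lemma product_state_unit_vec:
  assumes "r < 4" "c < 4" "i < 2" "j < 2"
  shows "product_state (unit_vec 2 i) (unit_vec 2 j) $$ (r,c) = of_bool (r = 2*i+j \<and> c = 2*i+j)"
proof -
  have digits: "r = 2*i+j \<longleftrightarrow> r div 2 = i \<and> r mod 2 = j" for r
    using \<open>j < 2\<close> by presburger
  have "r div 2 < 2" "c div 2 < 2" using assms by auto
  then show ?thesis
    unfolding digits using assms
    by (simp add: product_state_def ketbra_def tensor2_def)
qed

text \<open>The Bell-diagonal states with all weights at most one half form an octahedron whose six
vertices are the midpoints of pairs of Bell states; each vertex is an equal mixture of two product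
states.\<close>

lemma separable_mixture_of_bell_pairs:
  fixes w12 w13 w14 w23 w24 w34 :: real
  assumes "w12 \<ge> 0" "w13 \<ge> 0" "w14 \<ge> 0" "w23 \<ge> 0" "w24 \<ge> 0" "w34 \<ge> 0"
    and "w12 + w13 + w14 + w23 + w24 + w34 = 1"
  shows "separable (mat 4 4 (\<lambda>rc. of_real ((w12+w13+w14)/2) * Phi 1 $$ rc
    + of_real ((w12+w23+w24)/2) * Phi 2 $$ rc + of_real ((w13+w23+w34)/2) * Phi 3 $$ rc
    + of_real ((w14+w24+w34)/2) * Phi 4 $$ rc))"
proof (rule separableI_list)
  \<comment> \<open>The midpoint of two Bell states is half the projector onto an eigenspace of ZZ
    (pairs 12, 34), XX (13, 24) or YY (23, 14). Such an eigenspace is spanned by two product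
    eigenvectors, with equal local eigenvalues for the first pair named in each case and opposite
    ones for the second.\<close>
  let ?xs = "[(w12/2, unit_vec 2 0, unit_vec 2 0), (w12/2, unit_vec 2 1, unit_vec 2 1),
    (w34/2, unit_vec 2 0, unit_vec 2 1), (w34/2, unit_vec 2 1, unit_vec 2 0),
    (w13/2, equator 1, equator 1), (w13/2, equator (-1), equator (-1)),
    (w24/2, equator 1, equator (-1)), (w24/2, equator (-1), equator 1),
    (w14/2, equator \<i>, equator (-\<i>)), (w14/2, equator (-\<i>), equator \<i>),
    (w23/2, equator \<i>, equator \<i>), (w23/2, equator (-\<i>), equator (-\<i>))]"
  show "\<forall>(p,\<phi>,\<chi>)\<in>set ?xs. p \<ge> 0 \<and> unit_vec2 \<phi> \<and> unit_vec2 \<chi>"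
    using assms by (simp add: unit_vec2_equator unit_vec2_unit_vec)
  show "(\<Sum>(p,\<phi>,\<chi>)\<leftarrow>?xs. p) = 1"
    using assms(7) by simp
  show "mat 4 4 (\<lambda>rc. of_real ((w12+w13+w14)/2) * Phi 1 $$ rc
    + of_real ((w12+w23+w24)/2) * Phi 2 $$ rc + of_real ((w13+w23+w34)/2) * Phi 3 $$ rc
    + of_real ((w14+w24+w34)/2) * Phi 4 $$ rc)
    = mat 4 4 (\<lambda>rc. \<Sum>(p,\<phi>,\<chi>)\<leftarrow>?xs. complex_of_real p * product_state \<phi> \<chi> $$ rc)"
    (is "mat 4 4 ?f = mat 4 4 ?g")
  proof (rule eq_matI, goal_cases)
    case (1 r c)
    then have rc: "r < 4" "c < 4" by auto
    have "r = 0 \<or> r = 1 \<or> r = 2 \<or> r = 3" "c = 0 \<or> c = 1 \<or> c = 2 \<or> c = 3"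
      using rc by linarith+
    then have "?f (r,c) = ?g (r,c)"
      unfolding Phi_explicit
      by (elim disjE; simp add: product_state_equator product_state_unit_vec del: One_nat_def) (simp_all add: field_simps)
    then show ?case using rc by simp
  qed auto
qed

section \<open>Overlap of separable states with the first Bell state\<close>

text \<open>The Cauchy-Schwarz bound, obtained by adding 2ac \<le> a^2 + c^2 and 2bd \<le> b^2 + d^2
  for the moduli of the coordinates.\<close>

lemma cmod_Bell1_product_le:
  assumes "unit_vec2 \<phi>" "unit_vec2 \<chi>"
  shows "(cmod (\<phi> $ 0 * \<chi> $ 0 + \<phi> $ 1 * \<chi> $ 1))\<^sup>2 \<le> 1"
proof -
  let ?a = "cmod (\<phi> $ 0)" and ?b = "cmod (\<phi> $ 1)" and ?c = "cmod (\<chi> $ 0)" and ?d = "cmod (\<chi> $ 1)"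
  have "?a\<^sup>2 + ?b\<^sup>2 = 1" "?c\<^sup>2 + ?d\<^sup>2 = 1"
    using assms by (simp_all add: unit_vec2_def numeral_eq_Suc)
  moreover have "2 * (?a * ?c) \<le> ?a\<^sup>2 + ?c\<^sup>2" "2 * (?b * ?d) \<le> ?b\<^sup>2 + ?d\<^sup>2"
    using sum_squares_bound[of ?a ?c] sum_squares_bound[of ?b ?d] by simp_all
  moreover have "cmod (\<phi> $ 0 * \<chi> $ 0 + \<phi> $ 1 * \<chi> $ 1) \<le> ?a * ?c + ?b * ?d"
    by (metis norm_mult norm_triangle_ineq)
  ultimately have "cmod (\<phi> $ 0 * \<chi> $ 0 + \<phi> $ 1 * \<chi> $ 1) \<le> 1" by linarith
  then show ?thesis by (simp add: power_le_one)
qed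

lemma sum_lessThan_2_4:
  "(\<Sum>i<2. f i) = f 0 + f (1::nat)"
  "(\<Sum>i<4. g i) = g 0 + g 1 + g 2 + g (3::nat)"
  for f g :: "nat \<Rightarrow> 'a::comm_monoid_add"
  by (simp_all add: numeral_eq_Suc)

text \<open>Each product state has overlap at most 1/2 with \<open>Bell1\<close>, and the overlap is
  affine in the state, so the bound passes to convex combinations.\<close>

lemma separable_Bell1_overlap:
  assumes "separable \<rho>"
  obtains x :: real where "0 \<le> x" "x \<le> 1/2" "qform 4 \<rho> (bell 1) = of_real x" "mtrace \<rho> = 1"
    "\<rho> \<in> carrier_mat 4 4"
proof -
  obtain m :: nat and p \<phi> \<chi> where
    p_all: "\<forall>k<m. p k \<ge> 0 \<and> unit_vec2 (\<phi> k) \<and> unit_vec2 (\<chi> k)"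
    and psum: "(\<Sum>k<m. p k) = 1"
    and \<rho>: "\<rho> = mat 4 4 (\<lambda>rc. \<Sum>k<m. complex_of_real (p k) * product_state (\<phi> k) (\<chi> k) $$ rc)"
    using assms unfolding separable_def by blast
  have p: "p k \<ge> 0 \<and> unit_vec2 (\<phi> k) \<and> unit_vec2 (\<chi> k)" if "k < m" for k
    using p_all that by blast
  \<comment> \<open>The overlap of the k-th product state with \<open>Bell1\<close>; the 1/2 is the
    square of the normalisation 1/sqrt 2.\<close>
  define y where "y k = (cmod (\<phi> k $ 0 * \<chi> k $ 0 + \<phi> k $ 1 * \<chi> k $ 1))\<^sup>2 / 2" for k
  have tr: "mtrace (product_state (\<phi> k) (\<chi> k)) = 1" if "k < m" for k
  proof -
    have "mtrace (product_state (\<phi> k) (\<chi> k)) =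
      complex_of_real ((\<Sum>i<2. (cmod (\<phi> k $ i))\<^sup>2) * (\<Sum>i<2. (cmod (\<chi> k $ i))\<^sup>2))"
      unfolding of_real_mult of_real_sum complex_norm_square
      by (simp add: mtrace_def product_state_def ketbra_def tensor2_def sum_lessThan_2_4 algebra_simps)
    moreover have "(\<Sum>i<2. (cmod (\<phi> k $ i))\<^sup>2) = 1" "(\<Sum>i<2. (cmod (\<chi> k $ i))\<^sup>2) = 1"
      using p[OF that] by (auto simp: unit_vec2_def)
    ultimately show ?thesis by (simp only: of_real_1 mult_1)
  qed
  have q: "qform 4 (product_state (\<phi> k) (\<chi> k)) (bell 1) = of_real (y k)" for k
    unfolding qform_bell Phi_explicit y_def of_real_divide complex_norm_square
    by (simp add: product_state_def ketbra_def tensor2_def sum_lessThan_2_4 field_simps)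
  have "qform 4 \<rho> (bell 1) = (\<Sum>k<m. of_real (p k) * qform 4 (product_state (\<phi> k) (\<chi> k)) (bell 1))"
    unfolding qform_bell \<rho>
    by (simp add: numeral_eq_Suc sum_distrib_left sum_distrib_right sum.distrib distrib_left mult_ac)
  also have "\<dots> = of_real (\<Sum>k<m. p k * y k)" unfolding q by simp
  finally have 1: "qform 4 \<rho> (bell 1) = of_real (\<Sum>k<m. p k * y k)" .
  have "mtrace \<rho> = (\<Sum>k<m. of_real (p k) * mtrace (product_state (\<phi> k) (\<chi> k)))"
    unfolding mtrace_def \<rho>
    by (simp add: numeral_eq_Suc sum.distrib distrib_left product_state_def ketbra_def)
  also have "\<dots> = of_real (\<Sum>k<m. p k)" by (simp add: tr)
  finally have 2: "mtrace \<rho> = 1" using psum by simp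
  have y: "0 \<le> y k" "y k \<le> 1/2" if "k < m" for k
    using cmod_Bell1_product_le p[OF that] unfolding y_def by auto
  have 3: "0 \<le> (\<Sum>k<m. p k * y k)" using p y by (intro sum_nonneg) auto
  have "(\<Sum>k<m. p k * y k) \<le> (\<Sum>k<m. p k * (1/2))"
    using p y by (intro sum_mono mult_left_mono) auto
  also have "\<dots> = 1/2" unfolding sum_distrib_right[symmetric] psum by simp
  finally show ?thesis using that 1 2 3 by (simp add: \<rho>)
qed

section \<open>Preservation of separability and the target state\<close>

lemma non_entangling_bell_channel:
  assumes t: "0 \<le> t2" "0 \<le> t3" "0 \<le> t4" "t2 \<le> 1/2" "t3 \<le> 1/2" "t4 \<le> 1/2" "t2 + t3 + t4 = 1"
  shows "non_entangling (bell_channel t2 t3 t4)"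
  unfolding non_entangling_def
proof (intro conjI allI impI)
  show "CPTP (bell_channel t2 t3 t4)" using t by (intro CPTP_bell_channel)
  fix \<rho> assume "separable \<rho>"
  then obtain x where x: "0 \<le> x" "x \<le> 1/2" "qform 4 \<rho> (bell 1) = of_real x" "mtrace \<rho> = 1"
    "\<rho> \<in> carrier_mat 4 4" by (rule separable_Bell1_overlap)
  \<comment> \<open>The output is x \<Phi>1 + (1 - x) \<tau> = 2x (\<Phi>1 + \<tau>)/2 + (1 - 2x) \<tau>, where \<tau> = t2 \<Phi>2 + t3 \<Phi>3 + t4 \<Phi>4
    puts weight 1 - 2 t4 on the midpoint of \<Phi>2 and \<Phi>3, and similarly for the other pairs.\<close>
  define w where "w = (\<lambda>s. (1 - 2*x) * (1 - 2*s))"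
  \<comment> \<open>The first factor of \<open>w\<close> is nonnegative by the overlap bound, the
    second because each of \<open>t2\<close>, \<open>t3\<close>, \<open>t4\<close> is at most
    1/2.\<close>
  have w: "0 \<le> w t2" "0 \<le> w t3" "0 \<le> w t4" using x t by (simp_all add: w_def)
  have t4: "t4 = 1 - t2 - t3" using t by simp
  \<comment> \<open>The six pair weights sum to 1, and half the sum of the three weights meeting
    each Bell state is its weight in the output.\<close>
  have s: "2*x*t2 + 2*x*t3 + 2*x*t4 + w t4 + w t3 + w t2 = 1"
    "(2*x*t2 + 2*x*t3 + 2*x*t4)/2 = x" "(2*x*t2 + w t4 + w t3)/2 = (1-x)*t2"
    "(2*x*t3 + w t4 + w t2)/2 = (1-x)*t3" "(2*x*t4 + w t3 + w t2)/2 = (1-x)*t4"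
    unfolding w_def t4 by (simp_all add: field_simps)
  have "bell_channel t2 t3 t4 \<rho> = mat 4 4 (\<lambda>rc. of_real x * Phi 1 $$ rc
    + of_real ((1-x)*t2) * Phi 2 $$ rc + of_real ((1-x)*t3) * Phi 3 $$ rc
    + of_real ((1-x)*t4) * Phi 4 $$ rc)"
    unfolding bell_channel_eq[OF t(1-3) x(5)] x(3,4)
    by (simp add: algebra_simps)
  then show "separable (bell_channel t2 t3 t4 \<rho>)"
    using separable_mixture_of_bell_pairs[of "2*x*t2" "2*x*t3" "2*x*t4" "w t4" "w t3" "w t2"]
      x t w s by simp
qed

lemma rho_lam_carrier [simp]: "rho_lam l1 l2 l3 l4 \<in> carrier_mat 4 4"
  by (simp add: rho_lam_def ketbra_def)

lemma mtrace_rho_lam: "mtrace (rho_lam l1 l2 l3 l4) = of_real (l1 + l2 + l3 + l4)"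
  unfolding rho_lam_def Phi_explicit
  by (simp add: mtrace_def ketbra_def ket_def numeral_eq_Suc)

text \<open>The vectors |01>, |10> and \<open>Bell2\<close> are orthogonal to \<open>Bell1\<close>,
  so only the first term contributes.\<close>

lemma qform_rho_lam_bell1: "qform 4 (rho_lam l1 l2 l3 l4) (bell 1) = of_real l1"
  unfolding qform_bell rho_lam_def Phi_explicit
  by (simp add: ketbra_def ket_def numeral_eq_Suc)

theorem theorem3:
  fixes l1 l2 l3 l4 :: real
  assumes "l1 \<ge> l2" and "l2 \<ge> l3" and "l3 \<ge> l4" and "l4 \<ge> 0"
    and "l1 + l2 + l3 + l4 = 1"
    and "1 - l1 - 2 * l2 \<ge> 0"
  shows "\<exists>\<Lambda>. non_entangling \<Lambda> \<and> \<Lambda> (rho_lam l1 l2 l3 l4) = sigma_lam l1 l2 l3 l4"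
proof -
  \<comment> \<open>For l1 = 1 the failure branch has probability 0, so any admissible weights will do.\<close>
  define t where "t l = (if l1 = 1 then 1/3 else l / (1 - l1))" for l :: real
  have l1: "l1 \<le> 1" using assms by linarith
  \<comment> \<open>The bound 1/2 is the hypothesis 2 l2 \<le> 1 - l1 together with l4 \<le> l3
    \<le> l2. If l1 = 1, then l2, l3 and l4 vanish, so the three product identities still
    hold.\<close>
  have t: "0 \<le> t l2" "0 \<le> t l3" "0 \<le> t l4" "t l2 \<le> 1/2" "t l3 \<le> 1/2" "t l4 \<le> 1/2"
    "(1 - l1) * t l2 = l2" "(1 - l1) * t l3 = l3" "(1 - l1) * t l4 = l4"
    using assms l1 by (auto simp: t_def field_simps)
  have tsum: "t l2 + t l3 + t l4 = 1"
  proof (cases "l1 = 1")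
    case False
    then have "t l2 + t l3 + t l4 = (l2 + l3 + l4) / (1 - l1)"
      by (simp add: t_def add_divide_distrib)
    also have "l2 + l3 + l4 = 1 - l1" using assms by simp
    finally show ?thesis using False by simp
  qed (simp add: t_def)
  \<comment> \<open>The input has trace 1 and overlap l1 with \<open>Bell1\<close>, so the failure
    branch has probability 1 - l1.\<close>
  have "bell_channel (t l2) (t l3) (t l4) (rho_lam l1 l2 l3 l4) =
    mat 4 4 (\<lambda>rc. of_real l1 * Phi 1 $$ rc + of_real ((1 - l1) * t l2) * Phi 2 $$ rc
      + of_real ((1 - l1) * t l3) * Phi 3 $$ rc + of_real ((1 - l1) * t l4) * Phi 4 $$ rc)"
    unfolding bell_channel_eq[OF t(1-3) rho_lam_carrier] qform_rho_lam_bell1 mtrace_rho_lam assms(5)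
    by (simp add: algebra_simps)
  also have "\<dots> = sigma_lam l1 l2 l3 l4"
    unfolding t(7-9) sigma_lam_def by (intro eq_matI) auto
  finally show ?thesis
    using non_entangling_bell_channel[OF t(1-6) tsum] by blast
qed

end
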